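(* Let $\mathbf{k}$ be a field of characteristic zero and let $K=\mathbf{k}(x,y)$ be the skew-field of rational functions in non-commutative variables $x$ and $y$. For $r\in\mathbb{Z}_{>0}$ let $F_r$ be the $\mathbf{k}$-linear automorphism of the skew-field $K$ determined by $$F_r:\ x\mapsto xyx^{-1},\qquad y\mapsto (1+y^r)x^{-1}.$$ Then for any $r_1,r_2\in\mathbb{Z}_{>0}$ and any integer $k\ge 0$, the element $$x_k=\underbrace{F_{r_1}F_{r_2}F_{r_1}\cdots}_{k}(x)\in K$$ is a non-commutative Laurent polynomial in $x$ and $y$ with non-negative integer coefficients.
   Context: The skew-field $K=\mathbf{k}(x,y)$ is the free skew-field (universal field of fractions of the free associative algebra $\mathbf{k}\langle x,y\rangle$). The expression $\underbrace{F_{r_1}F_{r_2}F_{r_1}\cdots}_{k}$ is the composition of $k$ automorphisms, whose indices read from left to right alternate $r_1,r_2,r_1,\dots$ starting with $r_1$ (so $x_0=x$, $x_1=F_{r_1}(x)$, $x_2=F_{r_1}(F_{r_2}(x))$, $x_3=F_{r_1}(F_{r_2}(F_{r_1}(x)))$, etc.). A non-commutative Laurent polynomial in $x,y$ with non-negative integer coefficients is a finite sum, with non-negative integer coefficients, of words in $x,x^{-1},y,y^{-1}$. *)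

theory Defs
  imports "HOL-Algebra.Generated_Fields" "HOL-Algebra.Algebraic_Closure_Type" "HOL-Library.Poly_Mapping"
begin

section \<open>The free associative algebra\<close>

text \<open>
  The free monoid on \<open>'v\<close>, written additively because \<^type>\<open>poly_mapping\<close> turns a
  \<^class>\<open>monoid_add\<close> of exponents into a ring with the convolution product.  (Lists
  themselves are wrapped, since HOL-Library already has a pointwise addition on lists.)
  The type \<open>'v free_monoid \<Rightarrow>\<^sub>0 'k\<close> is thus the free associative algebra on \<open>'v\<close> over \<open>'k\<close>.
\<close>

datatype 'v free_monoid = Word (letters: "'v list")

instantiation free_monoid :: (type) monoid_add
begin

definition zero_free_monoid :: "'v free_monoid" where
  "zero_free_monoid = Word []"

definition plus_free_monoid :: "'v free_monoid \<Rightarrow> 'v free_monoid \<Rightarrow> 'v free_monoid" where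
  "plus_free_monoid u v = Word (letters u @ letters v)"

instance
  by standard (simp_all add: zero_free_monoid_def plus_free_monoid_def)

end

type_synonym ('v, 'k) free_algebra = "'v free_monoid \<Rightarrow>\<^sub>0 'k"

definition scalar :: "'k \<Rightarrow> ('v, 'k::zero) free_algebra" where
  "scalar c = Poly_Mapping.single 0 c"

definition gen :: "'v \<Rightarrow> ('v, 'k::zero_neq_one) free_algebra" where
  "gen v = Poly_Mapping.single (Word [v]) 1"

datatype two_vars = X_var | Y_var


section \<open>Universal fields of fractions\<close>

text \<open>P. M. Cohn's terminology: fields need not be commutative, and an \<open>R\<close>-field is a skew-field
  \<open>K\<close> with a ring homomorphism \<open>\<phi> : R \<rightarrow> K\<close>.\<close>

definition skew_field :: "('a, 'm) ring_scheme \<Rightarrow> bool" where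
  "skew_field K \<longleftrightarrow> Ring.ring K \<and> Units K = carrier K - {\<zero>\<^bsub>K\<^esub>}"

text \<open>Despite its name, \<^const>\<open>generate_field\<close> does not involve commutativity: it is the closure
  under the skew-field operations.\<close>

definition epic_field ::
    "('r, 'm) ring_scheme \<Rightarrow> ('a, 'n) ring_scheme \<Rightarrow> ('r \<Rightarrow> 'a) \<Rightarrow> bool" where
  "epic_field R K \<phi> \<longleftrightarrow>
     skew_field K \<and> \<phi> \<in> ring_hom R K \<and> generate_field K (\<phi> ` carrier R) = carrier K"

text \<open>A specialization is represented by a subhomomorphism: a homomorphism over \<open>R\<close> to \<open>L\<close> from a
  subring \<open>D\<close> of \<open>K\<close> in which every element outside the kernel is invertible.\<close>

definition specialization ::
    "('r, 'm) ring_scheme \<Rightarrow> ('a, 'n) ring_scheme \<Rightarrow> ('r \<Rightarrow> 'a) \<Rightarrow>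
     ('b, 'l) ring_scheme \<Rightarrow> ('r \<Rightarrow> 'b) \<Rightarrow> 'a set \<Rightarrow> ('a \<Rightarrow> 'b) \<Rightarrow> bool" where
  "specialization R K \<phi> L \<psi> D f \<longleftrightarrow>
     subring D K \<and> \<phi> ` carrier R \<subseteq> D \<and>
     f \<in> ring_hom (K\<lparr>carrier := D\<rparr>) L \<and>
     (\<forall>a\<in>carrier R. f (\<phi> a) = \<psi> a) \<and>
     (\<forall>d\<in>D. f d \<noteq> \<zero>\<^bsub>L\<^esub> \<longrightarrow> inv\<^bsub>K\<^esub> d \<in> D)"

text \<open>
  The competing epic \<open>R\<close>-fields \<open>L\<close> have carriers inside the type of the elements of \<open>K\<close>.
  For infinite \<open>R\<close> this loses no generality: being generated by the image of \<open>R\<close>, an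
  epic \<open>R\<close>-field has at most as many elements as \<open>R\<close>, and \<open>R\<close> embeds in \<open>K\<close>, so every epic
  \<open>R\<close>-field has an isomorphic copy among these \<open>L\<close>.  Uniqueness of the specialization (up to
  agreement on a common restriction) is automatic for epic \<open>R\<close>-fields.
\<close>

definition universal_field_of_fractions ::
    "('r, 'm) ring_scheme \<Rightarrow> 'a ring \<Rightarrow> ('r \<Rightarrow> 'a) \<Rightarrow> bool" where
  "universal_field_of_fractions R K \<phi> \<longleftrightarrow>
     epic_field R K \<phi> \<and> inj_on \<phi> (carrier R) \<and>
     (\<forall>(L :: 'a ring) \<psi>. epic_field R L \<psi> \<longrightarrow> (\<exists>D f. specialization R K \<phi> L \<psi> D f))"


section \<open>Alternating compositions and Laurent polynomials\<close>

text \<open>\<open>F r \<circ> F s \<circ> F r \<circ> \<dots>\<close> with \<open>k\<close> factors; the outermost one is \<open>F r\<close>.\<close>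

fun alternating_comp :: "(nat \<Rightarrow> 'a \<Rightarrow> 'a) \<Rightarrow> nat \<Rightarrow> nat \<Rightarrow> nat \<Rightarrow> 'a \<Rightarrow> 'a" where
  "alternating_comp F r s 0 = id"
| "alternating_comp F r s (Suc k) = F r \<circ> alternating_comp F s r k"

definition nonneg_laurent_polynomial :: "'a::division_ring \<Rightarrow> 'a \<Rightarrow> 'a \<Rightarrow> bool" where
  "nonneg_laurent_polynomial x y p \<longleftrightarrow>
     (\<exists>W (c :: 'a list \<Rightarrow> nat).
        finite W \<and> W \<subseteq> lists {x, inverse x, y, inverse y} \<and>
        p = (\<Sum>w\<in>W. of_nat (c w) * prod_list w))"

end

(* Put q = x y x^-1 y^-1. Every F_r fixes q, and x_{k+1} = q y_k for y_k = F_{r1} F_{r2} ... (y).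
   Up to conjugation by x, y_k is a sum over labelled words: a word in two letters is fixed, its
   horizontal letters contribute x^-1 or x^-1 y^s, its vertical letters y^-1 or x^r y^-1, and the
   products are multiplied out from left to right. A labelling is discarded as soon as some x^r
   has to pass a factor x^-1 y^e with e > 0. The map F_r turns the sum for a word made of blocks
   h v^j into the sum, with r and s exchanged, for the word in which each block h v^j is replaced
   by h^(s-j) v: under F_r a vertical letter acquires (1 + y^r)^-1, which either cancels against
   the factor 1 + y^r coming from the horizontal letter that stops it, or disappears because both
   labels of the vertical letter are allowed. If r1 r2 >= 4, the words remain of block form
   forever. If r1 r2 <= 3, they shrink to the single letter v, after which the sequence repeats:
   x_{k+N} = q x_k q^-1. *)

theory Submission
  imports Defs
begin

section \<open>Words and the stack automaton\<close>

text \<open>\<open>Hor\<close> and \<open>Ver\<close> are the letters whose labels are summed over; \<open>Yinv\<close> and \<open>Xfac\<close> stand for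
  single factors \<open>y\<^sup>-\<^sup>1\<close> and \<open>x\<close>.\<close>

datatype letter = Hor | Ver | Yinv | Xfac

text \<open>A stack lists, top first, the exponents \<open>e\<close> of the trailing factors \<open>x\<^sup>-\<^sup>1 y\<^sup>e\<close> of the product
  so far. A factor \<open>x\<close> cancels the top if \<open>e = 0\<close> and is forbidden if \<open>e > 0\<close>. If \<open>e < 0\<close>, it is allowed
  but never cancels anything again, so the stack can be forgotten.\<close>

fun pop :: "int list \<Rightarrow> int list option" where
  "pop [] = Some []"
| "pop (e # st) = (if e = 0 then Some st else if e > 0 then None else Some [])"

primrec pops :: "nat \<Rightarrow> int list \<Rightarrow> int list option" where
  "pops 0 st = Some st"
| "pops (Suc n) st = Option.bind (pop st) (pops n)"

text \<open>A factor y^-1 lowers only the last exponent, possibly below 0. On the empty stack every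
  later x is allowed, so nothing need be recorded.\<close>

fun dec :: "int list \<Rightarrow> int list" where
  "dec [] = []"
| "dec (e # st) = (e - 1) # st"

definition block_word :: "nat list \<Rightarrow> letter list" where
  "block_word js = concat (map (\<lambda>j. Hor # replicate j Ver) js)"

text \<open>Meant for \<open>j \<le> s\<close>, where the subtraction is not truncated. For
  \<open>j = s\<close> the lone \<open>Ver\<close> joins the preceding letters.\<close>

definition mutated_word :: "nat \<Rightarrow> nat list \<Rightarrow> letter list" where
  "mutated_word s js = concat (map (\<lambda>j. replicate (s - j) Hor @ [Ver]) js)"

text \<open>An entry \<open>e \<ge> 0\<close> stands for \<open>x\<^sup>-\<^sup>1 y\<^sup>e\<close>, which the automorphism maps to
  \<open>(x\<^sup>-\<^sup>1 (1 + y\<^sup>r))\<^sup>e y\<^sup>-\<^sup>1\<close>: that is \<open>e\<close> unlabelled horizontal letters and one \<open>y\<^sup>-\<^sup>1\<close>.\<close>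

fun stack_word :: "int list \<Rightarrow> letter list" where
  "stack_word [] = []"
| "stack_word (e # st) = stack_word st @ replicate (nat e) Hor @ [Yinv]"

lemma pops_Nil [simp]: "pops n [] = Some []"
  by (induction n) auto

lemma pops_zeros: "pops (m + n) (replicate m 0 @ st) = pops n st"
  by (induction m) auto

lemma stack_word_zeros: "stack_word (replicate k 0 @ st) = stack_word st @ replicate k Yinv"
  by (induction k) (auto simp: replicate_append_same)

section \<open>Evaluation of words as sums over labellings\<close>

locale laurent_pair =
  fixes x y :: "'a::division_ring"
  assumes x_nz [simp]: "x \<noteq> 0" and y_nz [simp]: "y \<noteq> 0"
begin

text \<open>\<open>r\<close> and \<open>s\<close> are the exponents of x and y in the second labels
  of \<open>Ver\<close> and \<open>Hor\<close>. The sum is unfolded from the left; a labelling that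
  gets stuck contributes 0.\<close>

primrec run :: "nat \<Rightarrow> nat \<Rightarrow> int list \<Rightarrow> letter list \<Rightarrow> 'a" where
  "run r s st [] = 1"
| "run r s st (a # w) = (case a of
     Hor \<Rightarrow> inverse x * run r s (0 # st) w + inverse x * y ^ s * run r s (int s # st) w
   | Ver \<Rightarrow> inverse y * run r s (dec st) w +
       (case pops r st of None \<Rightarrow> 0 | Some st' \<Rightarrow> x ^ r * inverse y * run r s (dec st') w)
   | Yinv \<Rightarrow> inverse y * run r s (dec st) w
   | Xfac \<Rightarrow> (case pop st of None \<Rightarrow> 0 | Some st' \<Rightarrow> x * run r s st' w))"

primrec free_value :: "nat \<Rightarrow> letter list \<Rightarrow> 'a" where
  "free_value s [] = 1"
| "free_value s (a # w) =
     (if a = Hor then inverse x * (1 + y ^ s) else inverse y) * free_value s w"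

lemma free_value_append: "free_value s (u @ w) = free_value s u * free_value s w"
  by (induction u) (auto simp: mult.assoc)

lemma free_value_replicate_H: "free_value s (replicate n Hor) = (inverse x * (1 + y ^ s)) ^ n"
  by (induction n) auto

lemma free_value_replicate_Y: "free_value s (replicate n Yinv) = inverse y ^ n"
  by (induction n) auto

lemma free_value_stack_word_Cons:
  "free_value s (stack_word (e # st)) =
     free_value s (stack_word st) * (inverse x * (1 + y ^ s)) ^ nat e * inverse y"
  by (simp add: free_value_append free_value_replicate_H mult.assoc)

text \<open>The prefix influences the rest only through the stack; if the rest ignores the stack,
  the sum factors.\<close>

lemma run_append_const:
  assumes "set u \<subseteq> {Hor, Yinv}" and "\<And>st. run r s st w = c"
  shows "run r s st (u @ w) = free_value s u * c"
  using assms(1)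
proof (induction u arbitrary: st)
  case (Cons a u)
  then have "a = Hor \<or> a = Yinv" by auto
  with Cons show ?case by (auto simp: algebra_simps)
qed (simp add: assms)

text \<open>Allows local rewriting behind a prefix: the summand \<open>c\<close> ignores the stack
  and therefore collects the full value of the prefix.\<close>

lemma run_append_add:
  assumes "set u \<subseteq> {Hor, Yinv}" and "\<And>st. run r s st w = c + run r s st w'"
  shows "run r s st (u @ w) = free_value s u * c + run r s st (u @ w')"
  using assms(1)
proof (induction u arbitrary: st)
  case (Cons a u)
  then have "a = Hor \<or> a = Yinv" by auto
  with Cons show ?case by (auto simp: algebra_simps)
qed (simp add: assms)

lemma run_append_plus:
  assumes "set u \<subseteq> {Hor, Yinv}" and "\<And>st. run r s st w = run r s st w1 + run r s st w2"
  shows "run r s st (u @ w) = run r s st (u @ w1) + run r s st (u @ w2)"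
  using assms(1)
proof (induction u arbitrary: st)
  case (Cons a u)
  then have "a = Hor \<or> a = Yinv" by auto
  with Cons show ?case by (auto simp: algebra_simps)
qed (simp add: assms)

lemma run_append_cong:
  assumes "set u \<subseteq> {Hor, Yinv}" and "\<And>st. run r s st w = run r s st w'"
  shows "run r s st (u @ w) = run r s st (u @ w')"
  using run_append_add[OF assms(1), of r s w 0 w'] assms(2) by simp

lemma set_stack_word: "set (stack_word st) \<subseteq> {Hor, Yinv}"
  by (induction st) auto

section \<open>Rewriting rules: expansion of \<open>Ver\<close>, forgetting the stack,
  cancellation\<close>

lemma run_replicate_X:
  "run r s st (replicate n Xfac @ w) =
     (case pops n st of None \<Rightarrow> 0 | Some st' \<Rightarrow> x ^ n * run r s st' w)"
  by (induction n arbitrary: st) (auto split: option.splits simp: mult.assoc)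

lemma run_Ver: "run r s st (Ver # w) = run r s st (Yinv # w) + run r s st (replicate r Xfac @ Yinv # w)"
  by (simp add: run_replicate_X mult.assoc split: option.splits)

text \<open>A negative entry either is not reached and survives, or ends the popping with an empty
  stack, as the bottom of the stack would.\<close>

lemma pops_wall:
  assumes "e < 0"
  shows "pops n (u @ e # st) = pops n u \<or>
         (\<exists>u'. pops n (u @ e # st) = Some (u' @ e # st) \<and> pops n u = Some u')"
proof (induction n arbitrary: u)
  case (Suc n)
  show ?case
  proof (cases u)
    case (Cons a u')
    then show ?thesis using Suc[of u'] by auto
  qed (use assms in auto)
qed auto

text \<open>Decrements keep a negative entry negative, so it stays a wall that hides everything
  below it.\<close>

lemma run_wall:
  assumes "e < 0"
  shows "run r s (u @ e # st) w = run r s u w"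
  using assms
proof (induction w arbitrary: u e)
  case (Cons a w)
  note IH = Cons.IH
  have dec: "run r s (dec (u @ e # st)) w = run r s (dec u) w" if "e < 0" for u e
  proof (cases u)
    case Nil
    then show ?thesis using IH[of "e - 1" "[]"] that by simp
  next
    case (Cons b u')
    then show ?thesis using IH[of e "(b - 1) # u'"] that by simp
  qed
  show ?case
  proof (cases a)
    case Hor
    then show ?thesis using IH[of e "0 # u"] IH[of e "int s # u"] Cons.prems by simp
  next
    case Ver
    then show ?thesis
      using pops_wall[OF Cons.prems, of r u st] dec[OF Cons.prems]
      by (auto split: option.splits)
  next
    case Yinv
    then show ?thesis using dec Cons.prems by simp
  next
    case Xfac
    show ?thesis
    proof (cases u)
      case Nil
      then show ?thesis using Xfac Cons.prems by simp
    next
      case (Cons b u')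
      then show ?thesis using Xfac IH[of e u'] Cons.prems by simp
    qed
  qed
qed simp

lemma run_neg: "e < 0 \<Longrightarrow> run r s (e # st) w = run r s [] w"
  using run_wall[of e r s "[]"] by simp

lemma dec_iterate_run:
  "run r s (e # st) (replicate k Yinv @ w) = inverse y ^ k * run r s ((e - int k) # st) w"
  by (induction k arbitrary: e) (auto simp: algebra_simps)

lemma run_Nil_Ys: "run r s [] (replicate k Yinv @ w) = inverse y ^ k * run r s [] w"
  by (induction k) (auto simp: mult.assoc)

lemma run_Nil_Xs: "run r s [] (replicate k Xfac @ w) = x ^ k * run r s [] w"
  by (simp add: run_replicate_X)

text \<open>The label x^-1 cancels the x; the label x^-1 y^s is discarded, since
  \<open>s > 0\<close> puts a positive entry on top.\<close>

lemma run_HX: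
  assumes "s > 0"
  shows "run r s st (Hor # Xfac # w) = run r s st w"
  using assms by (simp add: mult.assoc[symmetric])

lemma run_HsXs:
  assumes "s > 0"
  shows "run r s st (replicate n Hor @ replicate n Xfac @ w) = run r s st w"
proof (induction n arbitrary: w)
  case (Suc n)
  have "replicate (Suc n) Hor @ replicate (Suc n) Xfac @ w
      = replicate n Hor @ Hor # Xfac # replicate n Xfac @ w"
    by (simp add: replicate_app_Cons_same)
  also have "run r s st \<dots> = run r s st (replicate n Hor @ replicate n Xfac @ w)"
    by (rule run_append_cong) (auto simp del: run.simps simp: run_HX[OF assms])
  finally show ?case using Suc by simp
qed simp

text \<open>The two labels leave -k and s - k on top. The sign decides whether x is forbidden,
  cancels, or passes with the stack forgotten.\<close>

lemma run_HYX:
  assumes "k > 0"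
  shows "run r s st (Hor # replicate k Yinv @ Xfac # w) =
     inverse x * inverse y ^ k * x * run r s [] w +
     (if k < s then 0 else if k = s then run r s st w
      else inverse x * y ^ s * inverse y ^ k * x * run r s [] w)"
proof -
  have "inverse x * (y ^ s * (inverse y ^ s * (x * z))) = z" for z
    by (simp add: power_inverse mult.assoc[symmetric])
  then show ?thesis using assms
    by (auto simp: dec_iterate_run mult.assoc)
qed

end

section \<open>The image of a word under the automorphism\<close>

text \<open>\<open>\<Psi>\<close> is \<open>F\<^sub>r\<close> followed by conjugation with \<open>y x\<^sup>-\<^sup>1\<close>, see \<open>mutation_F\<close> below.\<close>

locale mutation = laurent_pair x y for x y :: "'a::division_ring" +
  fixes r s :: nat and \<Psi> :: "'a \<Rightarrow> 'a"
  assumes r_pos: "r > 0" and s_pos: "s > 0"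
    and add: "\<Psi> (a + b) = \<Psi> a + \<Psi> b"
    and mult: "\<Psi> (a * b) = \<Psi> a * \<Psi> b"
    and one: "\<Psi> 1 = 1"
    and \<Psi>_x: "\<Psi> x = y"
    and \<Psi>_y: "\<Psi> y = y * inverse x * (1 + y ^ r) * inverse y"
begin

lemma zero: "\<Psi> 0 = 0"
  using add[of 0 0] by simp

lemma inverse: "\<Psi> (inverse a) = inverse (\<Psi> a)"
proof (cases "a = 0")
  case False
  then have "\<Psi> a * \<Psi> (inverse a) = 1" by (simp flip: mult add: one)
  then show ?thesis by (metis inverse_unique)
qed (simp add: zero)

lemma power: "\<Psi> (a ^ n) = \<Psi> a ^ n"
  by (induction n) (auto simp: one mult)

text \<open>Otherwise \<open>\<Psi>\<close> would send the unit y to 0.\<close>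

lemma y_image_nz: "1 + y ^ r \<noteq> 0"
proof
  assume "1 + y ^ r = 0"
  then have "\<Psi> y = 0" by (simp add: \<Psi>_y)
  moreover have "\<Psi> y * \<Psi> (inverse y) = 1" by (simp flip: mult add: one)
  ultimately show False by simp
qed

section \<open>Images of the labels\<close>

abbreviation "T \<equiv> 1 + y ^ r"

lemma T_y: "y * T = T * y"
  by (simp add: algebra_simps power_commutes)

lemma T_inv_y: "inverse T * y = y * inverse T"
  by (metis T_y inverse_zero mult_commute_imp_mult_inverse_commute)

lemma T_inv_yi: "inverse T * inverse y = inverse y * inverse T"
  by (metis T_inv_y inverse_zero mult_commute_imp_mult_inverse_commute)

lemma T_inv_yi_pow: "inverse T * inverse y ^ k = inverse y ^ k * inverse T"
proof (induction k)
  case (Suc k)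
  have "inverse T * inverse y ^ Suc k = inverse y * (inverse T * inverse y ^ k)"
    by (simp add: T_inv_yi mult.assoc[symmetric])
  then show ?case by (simp add: Suc mult.assoc)
qed simp

lemma yi_pow_y: "inverse y * inverse y ^ k * y = inverse y ^ k"
  by (simp only: power_commutes[symmetric] mult.assoc left_inverse y_nz not_False_eq_True
      mult_1_right)

lemma \<Psi>_xi: "\<Psi> (inverse x) = inverse y"
  by (simp add: inverse \<Psi>_x)

lemma \<Psi>_yi: "\<Psi> (inverse y) = y * inverse T * x * inverse y"
  using y_image_nz by (simp add: inverse \<Psi>_y nonzero_inverse_mult_distrib mult.assoc)

text \<open>Conjugation by y telescopes in the power. The result is the value of the letters that
  \<open>stack_word\<close> attaches to an entry \<open>e\<close>.\<close>

lemma \<Psi>_xi_y: "\<Psi> (inverse x * y ^ e) = (inverse x * T) ^ e * inverse y"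
proof -
  have "(y * inverse x * T * inverse y) ^ e = y * (inverse x * T) ^ e * inverse y"
    by (induction e) (auto simp: mult.assoc, simp add: mult.assoc[symmetric])
  then show ?thesis
    by (simp add: mult power \<Psi>_xi \<Psi>_y) (simp add: mult.assoc[symmetric])
qed

text \<open>The two labels add up to (1 + x^r) y^-1. The image T of the first factor commutes with y
  and cancels the inverse of T in the image of y^-1.\<close>

lemma \<Psi>_ver: "\<Psi> (inverse y + x ^ r * inverse y) = y * x * inverse y"
proof -
  have "\<Psi> (inverse y + x ^ r * inverse y) = T * \<Psi> (inverse y)"
    by (simp add: add mult power \<Psi>_x distrib_right)
  also have "\<dots> = y * T * inverse T * x * inverse y"
    by (simp only: \<Psi>_yi T_y mult.assoc[symmetric])
  finally show ?thesis using y_image_nz by (simp add: mult.assoc)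
qed

lemma run_Nil_Ver: "run r s [] (Ver # w) = (inverse y + x ^ r * inverse y) * run r s [] w"
  by (simp add: algebra_simps)

text \<open>On the empty stack both labels of every \<open>Ver\<close> survive; the resulting
  factors y x y^-1 telescope.\<close>

lemma image_run_Nil_Vers:
  assumes "\<Psi> (run r s [] D) = run s r [] D'"
  shows "\<Psi> (run r s [] (replicate j Ver @ D)) = y * x ^ j * inverse y * run s r [] D'"
proof (induction j)
  case (Suc j)
  have "\<Psi> (run r s [] (replicate (Suc j) Ver @ D))
      = y * x * inverse y * (y * x ^ j * inverse y * run s r [] D')"
    by (simp add: run_Nil_Ver mult \<Psi>_ver Suc del: run.simps)
  then show ?case by (simp add: mult.assoc) (simp add: mult.assoc[symmetric])
qed (simp add: assms)

section \<open>Induction over vertical letters and blocks\<close>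

abbreviation "val st \<equiv> free_value r (stack_word st)"

text \<open>The image of y^-1 cancels the last horizontal letter of the entry, T against its inverse
  and x^-1 against x.\<close>

lemma val_dec:
  assumes "e > 0"
  shows "val (e # st) * \<Psi> (inverse y) = val ((e - 1) # st)"
proof -
  obtain n where n: "nat e = Suc n" "nat (e - 1) = n"
    using assms by (metis Suc_nat_eq_nat_zadd1 diff_add_cancel add.commute le_diff_eq
      add_0 int_one_le_iff_zero_less)
  have "val (e # st) * \<Psi> (inverse y)
      = val st * (inverse x * T) ^ n * inverse x * (T * (inverse y * y) * inverse T) * x * inverse y"
    unfolding free_value_stack_word_Cons n \<Psi>_yi by (simp only: power_Suc2 mult.assoc)
  also have "\<dots> = val st * (inverse x * T) ^ n * (inverse x * x) * inverse y"
    using y_image_nz by (simp only: left_inverse right_inverse y_nz not_False_eq_True mult_1_right mult.assoc)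
  finally show ?thesis unfolding free_value_stack_word_Cons n by simp
qed

text \<open>Each \<open>Ver\<close> becomes one \<open>Xfac\<close> in front of the
  \<open>Yinv\<close> of the top entry: the labels of \<open>Ver\<close> that survive match the ways
  in which this x meets the preceding horizontal letters.\<close>

lemma image_run_Vers:
  assumes IH: "\<And>st. \<forall>e\<in>set st. 0 \<le> e \<Longrightarrow>
      val st * \<Psi> (run r s st D) = run s r [] (stack_word st @ D')"
    and "\<forall>e\<in>set (e # st). 0 \<le> e"
  shows "val (e # st) * \<Psi> (run r s (e # st) (replicate j Ver @ D)) =
    run s r [] (stack_word st @ replicate (nat e) Hor @ replicate j Xfac @ Yinv # D')"
  using assms(2)
proof (induction j arbitrary: e st)
  case 0
  then show ?case using IH[of "e # st"] by simp
next
  case (Suc j)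
  define w where "w = replicate j Ver @ D"
  define z where "z = replicate j Xfac @ Yinv # D'"
  define E where "E = run s r [] z"
  \<comment> \<open>The image of the rest after any label that lets the stack be forgotten.\<close>
  have bottom: "\<Psi> (run r s [] w) = y * E"
    unfolding w_def E_def z_def
    using image_run_Nil_Vers[of D D' j] IH[of "[]"] by (simp add: run_Nil_Xs mult.assoc)
  show ?case
  proof (cases "e > 0")
    case True
    then obtain n where n: "nat e = Suc n" "nat (e - 1) = n"
      by (metis Suc_nat_eq_nat_zadd1 diff_add_cancel add.commute le_diff_eq
        add_0 int_one_le_iff_zero_less)
    \<comment> \<open>Only the label y^-1 survives and deletes a horizontal letter; in the target
      word this is the cancellation of \<open>Hor\<close> with \<open>Xfac\<close>.\<close>
    have "pops r (e # st) = None"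
      using True r_pos by (cases r) auto
    then have "val (e # st) * \<Psi> (run r s (e # st) (replicate (Suc j) Ver @ D))
        = val ((e - 1) # st) * \<Psi> (run r s ((e - 1) # st) w)"
      using val_dec[OF True, of st] by (simp add: w_def mult mult.assoc[symmetric])
    also have "\<dots> = run s r [] (stack_word st @ replicate n Hor @ z)"
      unfolding w_def z_def using Suc.IH[of "e - 1" st] Suc.prems True n by simp
    also have "\<dots> = run s r [] ((stack_word st @ replicate n Hor) @ Hor # Xfac # z)"
      by (subst append_assoc[symmetric], rule run_append_cong)
         (use set_stack_word[of st] run_HX[OF r_pos] in auto)
    finally show ?thesis using n by (simp add: z_def replicate_app_Cons_same)
  next
    case False
    then have e: "e = 0" using Suc.prems by auto
    \<comment> \<open>The zeros on top decide how far x^r reaches; \<open>k\<close> below counts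
      them with \<open>e\<close> included.\<close>
    define k0 where "k0 = length (takeWhile (\<lambda>a. a = 0) st)"
    define st' where "st' = dropWhile (\<lambda>a. a = 0) st"
    have tw: "takeWhile (\<lambda>a. a = 0) st = replicate k0 0"
      unfolding k0_def by (rule replicate_length_same[symmetric]) (auto dest: set_takeWhileD)
    have st: "st = replicate k0 0 @ st'"
      using takeWhile_dropWhile_id[of "\<lambda>a. a = 0" st] by (simp only: tw st'_def)
    define k where "k = Suc k0"
    then have k_pos: "k > 0" by simp
    have est: "e # st = replicate k 0 @ st'" by (simp add: e st k_def)
    have val: "val (e # st) = val st' * inverse y ^ k"
      unfolding est stack_word_zeros free_value_append free_value_replicate_Y by simp
    have goal_word: "stack_word st @ replicate (nat e) Hor @ replicate (Suc j) Xfac @ Yinv # D'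
        = stack_word st' @ replicate k0 Yinv @ Xfac # z"
      by (simp add: st stack_word_zeros e z_def)
    have "run r s (dec (e # st)) w = run r s [] w"
      using run_neg[of "-1"] by (simp add: e)
    then have run: "run r s (e # st) (replicate (Suc j) Ver @ D) =
        inverse y * run r s [] w +
        (case pops r (e # st) of None \<Rightarrow> 0 | Some q \<Rightarrow> x ^ r * inverse y * run r s (dec q) w)"
      unfolding w_def by (simp del: dec.simps pops.simps)
    \<comment> \<open>No positive entry blocks x^r, so both labels occur and T cancels as in
      \<open>\<Psi>_ver\<close>.\<close>
    have free_case: ?thesis if "st' = []"
    proof -
      have "\<exists>q. pops r (e # st) = Some q \<and> run r s (dec q) w = run r s [] w"
      proof (cases "r \<le> k")
        case True
        then have "pops r (e # st) = Some (replicate (k - r) 0)"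
          using pops_zeros[of r 0 "replicate (k - r) 0"] est that
          by (simp flip: replicate_add)
        then show ?thesis using run_neg[of "-1"] by (cases "k - r") auto
      next
        case False
        then have "pops r (e # st) = Some []"
          using pops_zeros[of k "r - k" "[]"] est that by simp
        then show ?thesis by simp
      qed
      then have "val (e # st) * \<Psi> (run r s (e # st) (replicate (Suc j) Ver @ D))
        = inverse y ^ k * \<Psi> ((inverse y + x ^ r * inverse y) * run r s [] w)"
        unfolding run val that by (auto simp: distrib_right)
      also have "\<dots> = inverse y ^ k0 * (inverse y * y) * x * (inverse y * y) * E"
        unfolding mult \<Psi>_ver bottom k_def by (simp only: power_Suc2 mult.assoc)
      also have "\<dots> = inverse y ^ k0 * x * E" by simp
      finally show ?thesis unfolding goal_word that
        by (simp add: run_Nil_Ys E_def mult.assoc)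
    qed
    have bound_case: ?thesis if "st' = a # u" for a u
    proof -
      have a: "a > 0"
      proof -
        have "dropWhile (\<lambda>a. a = 0) st \<noteq> []" by (simp flip: st'_def add: that)
        from hd_dropWhile[OF this] have "a \<noteq> 0" by (simp flip: st'_def add: that)
        moreover have "a \<in> set st" by (subst st) (simp add: that)
        then have "a \<ge> 0" using Suc.prems by simp
        ultimately show ?thesis by simp
      qed
      obtain n where n: "nat a = Suc n" "nat (a - 1) = n"
        using a by (metis Suc_nat_eq_nat_zadd1 diff_add_cancel add.commute le_diff_eq
          add_0 int_one_le_iff_zero_less)
      \<comment> \<open>\<open>p\<close> stops just before the last horizontal letter of the entry
        \<open>a\<close>, the letter that will meet x.\<close>
      define p where "p = stack_word u @ replicate n Hor"
      have p: "set p \<subseteq> {Hor, Yinv}" using set_stack_word[of u] by (auto simp: p_def)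
      define P where "P = free_value r p"
      have valst': "val st' = P * inverse x * T * inverse y"
        unfolding that P_def p_def free_value_append free_value_replicate_H
        by (simp only: stack_word.simps n free_value_append free_value_replicate_H power_Suc2 mult.assoc)
           simp
      \<comment> \<open>The \<open>Yinv\<close> of \<open>a\<close> and those of the
        \<open>k0\<close> zeros in \<open>st\<close> make \<open>k\<close>; that of \<open>e\<close>
        stands behind the \<open>Xfac\<close> letters.\<close>
      have word: "stack_word st' @ replicate k0 Yinv @ Xfac # z
          = p @ Hor # replicate k Yinv @ Xfac # z"
        by (simp add: that n p_def k_def replicate_app_Cons_same)
      \<comment> \<open>The label y^-1: the inverse of T passes the powers of y^-1 and meets the T
        of that horizontal letter.\<close>
      have low: "val (e # st) * \<Psi> (inverse y) * y * E = P * (inverse x * inverse y ^ k * x * E)"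
      proof -
        have "val (e # st) * \<Psi> (inverse y) * y * E
            = P * inverse x * (T * (inverse y * inverse y ^ k * y * inverse T)) * x * (inverse y * y) * E"
          unfolding val valst' \<Psi>_yi by (simp only: mult.assoc)
        also have "inverse y * inverse y ^ k * y * inverse T = inverse T * inverse y ^ k"
          by (simp only: yi_pow_y T_inv_yi_pow)
        also have "P * inverse x * (T * (inverse T * inverse y ^ k)) * x * (inverse y * y) * E
            = P * inverse x * ((T * inverse T) * inverse y ^ k) * x * (inverse y * y) * E"
          by (simp only: mult.assoc)
        finally show ?thesis using y_image_nz
          by (simp only: left_inverse right_inverse y_nz not_False_eq_True mult_1_left
              mult_1_right mult.assoc)
      qed
      \<comment> \<open>x^r hits the positive entry \<open>a\<close>, uses up exactly the zeros, or
        leaves a zero that becomes -1. These are the branches of \<open>run_HYX\<close>.\<close>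
      consider "k < r" | "k = r" | "r < k" by linarith
      then show ?thesis
      proof cases
        case 1
        then obtain d where d: "r = k + Suc d" using less_imp_Suc_add by fastforce
        have "pops r (e # st) = None"
          unfolding est d pops_zeros using that a by simp
        then have "val (e # st) * \<Psi> (run r s (e # st) (replicate (Suc j) Ver @ D))
            = val (e # st) * \<Psi> (inverse y) * y * E"
          unfolding run by (simp add: mult bottom mult.assoc)
        also have "\<dots> = run s r [] (p @ Hor # replicate k Yinv @ Xfac # z)"
          unfolding low P_def by (rule run_append_const[OF p, symmetric])
            (use 1 run_HYX[OF k_pos] in \<open>simp add: E_def del: run.simps\<close>)
        finally show ?thesis unfolding goal_word word .
      next
        case 2
        have "pops r (e # st) = Some st'"
          using pops_zeros[of r 0 st'] est 2 by simp
        then have "val (e # st) * \<Psi> (run r s (e # st) (replicate (Suc j) Ver @ D))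
            = val (e # st) * \<Psi> (inverse y) * y * E
              + val (e # st) * y ^ r * \<Psi> (inverse y) * \<Psi> (run r s ((a - 1) # u) w)"
          unfolding run by (simp add: add mult power \<Psi>_x bottom that distrib_left mult.assoc)
        also have "val (e # st) * y ^ r * \<Psi> (inverse y) = val ((a - 1) # u)"
        proof -
          have "val (e # st) * y ^ r = val (a # u)"
            unfolding val 2 that by (simp add: mult.assoc power_inverse)
          then show ?thesis using val_dec[OF a, of u] by simp
        qed
        also have "val ((a - 1) # u) * \<Psi> (run r s ((a - 1) # u) w) = run s r [] (p @ z)"
          unfolding w_def z_def p_def using Suc.IH[of "a - 1" u] Suc.prems a n st that by simp
        also have "val (e # st) * \<Psi> (inverse y) * y * E + run s r [] (p @ z)
            = run s r [] (p @ Hor # replicate k Yinv @ Xfac # z)"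
          unfolding low P_def by (rule run_append_add[OF p, symmetric])
            (use 2 run_HYX[OF k_pos] in \<open>simp add: E_def del: run.simps\<close>)
        finally show ?thesis unfolding goal_word word .
      next
        case 3
        then obtain d where d: "k = r + Suc d" using less_imp_Suc_add by fastforce
        have "pops r (e # st) = Some (0 # replicate d 0 @ st')"
          unfolding est d using pops_zeros[of r 0 "0 # replicate d 0 @ st'"]
          by (simp only: replicate_add replicate_Suc append_assoc append_Cons append_Nil
              add_0_right pops.simps)
        then have "val (e # st) * \<Psi> (run r s (e # st) (replicate (Suc j) Ver @ D))
            = val (e # st) * \<Psi> ((inverse y + x ^ r * inverse y) * run r s [] w)"
          unfolding run using run_neg[of "-1"] by (simp add: distrib_right)
        also have "\<dots> = P * inverse x * T * (inverse y * inverse y ^ k * y) * x * (inverse y * y) * E"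
          unfolding mult \<Psi>_ver bottom val valst' by (simp only: mult.assoc)
        also have "inverse y * inverse y ^ k * y = inverse y ^ k"
          by (rule yi_pow_y)
        also have "P * inverse x * T * inverse y ^ k * x * (inverse y * y) * E
            = P * (inverse x * inverse y ^ k * x * E + inverse x * y ^ r * inverse y ^ k * x * E)"
          by (simp only: left_inverse y_nz not_False_eq_True mult_1_left mult_1_right
              distrib_left distrib_right mult.assoc)
        also have "\<dots> = run s r [] (p @ Hor # replicate k Yinv @ Xfac # z)"
          unfolding P_def by (rule run_append_const[OF p, symmetric])
            (use 3 run_HYX[OF k_pos] in \<open>simp add: E_def del: run.simps\<close>)
        finally show ?thesis unfolding goal_word word .
      qed
    qed
    show ?thesis using free_case bound_case by (cases st') auto
  qed
qed

text \<open>The stack is arbitrary because every \<open>Hor\<close> pushes an entry;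
  \<open>val st\<close> carries the images of the factors it records. Negative entries never enter,
  as \<open>run_neg\<close> forgets them.\<close>

lemma image_run_stack:
  assumes "\<forall>j\<in>set js. j \<le> s" and "\<forall>e\<in>set st. 0 \<le> e"
  shows "val st * \<Psi> (run r s st (block_word js)) = run s r [] (stack_word st @ mutated_word s js)"
  using assms
proof (induction js arbitrary: st)
  case Nil
  have "run s r [] (stack_word st @ []) = val st * 1"
    by (rule run_append_const) (auto simp: set_stack_word)
  then show ?case by (simp add: block_word_def mutated_word_def one)
next
  case (Cons j js)
  define D where "D = block_word js"
  define D' where "D' = mutated_word s js"
  have IH: "val st * \<Psi> (run r s st D) = run s r [] (stack_word st @ D')"
    if "\<forall>e\<in>set st. 0 \<le> e" for st
    using Cons that by (simp add: D_def D'_def)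
  define w where "w = replicate j Ver @ D"
  have "\<Psi> (run r s st (Hor # w))
      = \<Psi> (inverse x * run r s (0 # st) w) + \<Psi> (inverse x * y ^ s * run r s (int s # st) w)"
    by (simp add: add)
  then have "val st * \<Psi> (run r s st (Hor # w))
      = val (0 # st) * \<Psi> (run r s (0 # st) w) + val (int s # st) * \<Psi> (run r s (int s # st) w)"
    unfolding free_value_stack_word_Cons nat_int
      mult[of "inverse x * y ^ s" "run r s (int s # st) w"] \<Psi>_xi_y
      mult[of "inverse x" "run r s (0 # st) w"] \<Psi>_xi
    by (simp only: distrib_left mult.assoc nat_0 power_0 mult_1_left)
  also have "val (0 # st) * \<Psi> (run r s (0 # st) w)
      = run s r [] (stack_word st @ replicate j Xfac @ Yinv # D')"
    unfolding w_def using image_run_Vers[OF IH, of 0 st j] Cons.prems by simp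
  also have "val (int s # st) * \<Psi> (run r s (int s # st) w)
      = run s r [] (stack_word st @ replicate s Hor @ replicate j Xfac @ Yinv # D')"
    unfolding w_def using image_run_Vers[OF IH, of "int s" st j] Cons.prems by simp
  \<comment> \<open>Since \<open>j \<le> s\<close>, inserting s - j cancelling pairs turns x^j into
    s - j horizontal letters followed by x^s.\<close>
  also have "run s r [] (stack_word st @ replicate j Xfac @ Yinv # D')
      = run s r [] (stack_word st @ replicate (s - j) Hor @ replicate s Xfac @ Yinv # D')"
  proof (rule run_append_cong[OF set_stack_word])
    fix q
    have "replicate s Xfac = replicate (s - j) Xfac @ replicate j Xfac"
      using Cons.prems by (simp flip: replicate_add)
    then show "run s r q (replicate j Xfac @ Yinv # D')
        = run s r q (replicate (s - j) Hor @ replicate s Xfac @ Yinv # D')"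
      using run_HsXs[OF r_pos, of s q "s - j" "replicate j Xfac @ Yinv # D'"] by simp
  qed
  \<comment> \<open>Here \<open>j\<close> of the \<open>s\<close> horizontal letters cancel.\<close>
  also have "run s r [] (stack_word st @ replicate s Hor @ replicate j Xfac @ Yinv # D')
      = run s r [] ((stack_word st @ replicate (s - j) Hor) @ Yinv # D')"
  proof -
    have "replicate s Hor = replicate (s - j) Hor @ replicate j Hor"
      using Cons.prems by (simp flip: replicate_add)
    then have "stack_word st @ replicate s Hor @ replicate j Xfac @ Yinv # D'
        = (stack_word st @ replicate (s - j) Hor) @ replicate j Hor @ replicate j Xfac @ Yinv # D'"
      by simp
    also have "run s r [] \<dots> = run s r [] ((stack_word st @ replicate (s - j) Hor) @ Yinv # D')"
      by (rule run_append_cong)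
        (use set_stack_word[of st] run_HsXs[OF r_pos] in auto)
    finally show ?thesis .
  qed
  \<comment> \<open>The two terms now differ only by x^s: they are the two labels of one
    \<open>Ver\<close> for the exchanged exponents.\<close>
  also have "run s r [] (stack_word st @ replicate (s - j) Hor @ replicate s Xfac @ Yinv # D')
        + run s r [] ((stack_word st @ replicate (s - j) Hor) @ Yinv # D')
      = run s r [] ((stack_word st @ replicate (s - j) Hor) @ Ver # D')"
    by (simp only: append_assoc, rule run_append_plus[OF set_stack_word, symmetric],
        rule run_append_plus) (auto simp: run_Ver add.commute simp del: run.simps)
  finally show ?case by (simp add: D_def D'_def w_def block_word_def mutated_word_def)
qed

lemma image_run:
  assumes "\<forall>j\<in>set js. j \<le> s"
  shows "\<Psi> (run r s [] (block_word js)) = run s r [] (mutated_word s js)"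
  using image_run_stack[of js "[]"] assms by simp

end

section \<open>Positivity\<close>

lemma nonneg_laurent_0: "nonneg_laurent_polynomial x y 0"
  unfolding nonneg_laurent_polynomial_def by (intro exI[of _ "{}"]) auto

lemma nonneg_laurent_1: "nonneg_laurent_polynomial x y 1"
  unfolding nonneg_laurent_polynomial_def
  by (intro exI[of _ "{[]}"] exI[of _ "\<lambda>_. 1"]) auto

lemma nonneg_laurent_add:
  assumes "nonneg_laurent_polynomial x y p" "nonneg_laurent_polynomial x y q"
  shows "nonneg_laurent_polynomial x y (p + q)"
proof -
  let ?L = "lists {x, inverse x, y, inverse y}"
  obtain W c where W: "finite W" "W \<subseteq> ?L" "p = (\<Sum>w\<in>W. of_nat (c w) * prod_list w)"
    using assms(1) unfolding nonneg_laurent_polynomial_def by blast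
  obtain W' c' where W': "finite W'" "W' \<subseteq> ?L" "q = (\<Sum>w\<in>W'. of_nat (c' w) * prod_list w)"
    using assms(2) unfolding nonneg_laurent_polynomial_def by blast
  define d where "d w = (if w \<in> W then c w else 0) + (if w \<in> W' then c' w else 0)" for w
  have "p = (\<Sum>w\<in>W \<union> W'. of_nat (if w \<in> W then c w else 0) * prod_list w)"
    unfolding W(3) using W(1) W'(1) by (intro sum.mono_neutral_cong_left) auto
  moreover have "q = (\<Sum>w\<in>W \<union> W'. of_nat (if w \<in> W' then c' w else 0) * prod_list w)"
    unfolding W'(3) using W(1) W'(1) by (intro sum.mono_neutral_cong_left) auto
  ultimately have "p + q = (\<Sum>w\<in>W \<union> W'. of_nat (d w) * prod_list w)"
    by (simp only: d_def of_nat_add distrib_right sum.distrib)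
  then show ?thesis
    unfolding nonneg_laurent_polynomial_def
    using W W' by (intro exI[of _ "W \<union> W'"] exI[of _ d]) auto
qed

lemma nonneg_laurent_mult_left:
  assumes "nonneg_laurent_polynomial x y p" and a: "a \<in> {x, inverse x, y, inverse y}"
  shows "nonneg_laurent_polynomial x y (a * p)"
proof -
  let ?L = "lists {x, inverse x, y, inverse y}"
  obtain W c where W: "finite W" "W \<subseteq> ?L" "p = (\<Sum>w\<in>W. of_nat (c w) * prod_list w)"
    using assms(1) unfolding nonneg_laurent_polynomial_def by blast
  have sub: "(#) a ` W \<subseteq> ?L"
  proof (rule image_subsetI)
    fix w assume "w \<in> W"
    then show "a # w \<in> ?L" using subsetD[OF W(2)] a by simp
  qed
  have "a * p = (\<Sum>w\<in>W. of_nat (c w) * prod_list (a # w))"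
    unfolding W(3) sum_distrib_left
    by (intro sum.cong refl) (metis mult.assoc mult_of_nat_commute prod_list.Cons)
  \<comment> \<open>Prefixing \<open>a\<close> is injective on words, so \<open>tl\<close> recovers
    the old coefficient.\<close>
  also have "\<dots> = (\<Sum>w\<in>(#) a ` W. of_nat (c (tl w)) * prod_list w)"
    by (subst sum.reindex) auto
  finally show ?thesis
    unfolding nonneg_laurent_polynomial_def
    using W(1) sub by (intro exI[of _ "(#) a ` W"] exI[of _ "\<lambda>w. c (tl w)"]) auto
qed

lemma nonneg_laurent_mult_right:
  assumes "nonneg_laurent_polynomial x y p" and a: "a \<in> {x, inverse x, y, inverse y}"
  shows "nonneg_laurent_polynomial x y (p * a)"
proof -
  let ?L = "lists {x, inverse x, y, inverse y}"
  obtain W c where W: "finite W" "W \<subseteq> ?L" "p = (\<Sum>w\<in>W. of_nat (c w) * prod_list w)"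
    using assms(1) unfolding nonneg_laurent_polynomial_def by blast
  have sub: "(\<lambda>w. w @ [a]) ` W \<subseteq> ?L"
  proof (rule image_subsetI)
    fix w assume "w \<in> W"
    then show "w @ [a] \<in> ?L" using subsetD[OF W(2)] a by simp
  qed
  have "p * a = (\<Sum>w\<in>W. of_nat (c w) * prod_list (w @ [a]))"
    unfolding W(3) sum_distrib_right by (intro sum.cong) (simp_all add: mult.assoc)
  also have "\<dots> = (\<Sum>w\<in>(\<lambda>w. w @ [a]) ` W. of_nat (c (butlast w)) * prod_list w)"
    by (subst sum.reindex) (auto simp: inj_on_def)
  finally show ?thesis
    unfolding nonneg_laurent_polynomial_def
    using W(1) sub by (intro exI[of _ "(\<lambda>w. w @ [a]) ` W"] exI[of _ "\<lambda>w. c (butlast w)"]) auto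
qed

lemma nonneg_laurent_power_mult:
  assumes "nonneg_laurent_polynomial x y p" and "a \<in> {x, inverse x, y, inverse y}"
  shows "nonneg_laurent_polynomial x y (a ^ n * p)"
  by (induction n) (simp_all add: assms(1) mult.assoc nonneg_laurent_mult_left[OF _ assms(2)])

text \<open>\<open>run\<close> only adds and multiplies by x, y and their inverses; nothing is
  subtracted.\<close>

lemma (in laurent_pair) nonneg_laurent_run: "nonneg_laurent_polynomial x y (run r s st w)"
proof (induction w arbitrary: st)
  case (Cons a w)
  then show ?case
    by (cases a) (auto simp: mult.assoc split: option.splits intro!: nonneg_laurent_0
        nonneg_laurent_add nonneg_laurent_mult_left nonneg_laurent_power_mult)
qed (simp add: nonneg_laurent_1)

section \<open>Words of the cluster variables\<close>

lemma block_word_append: "block_word (js @ js') = block_word js @ block_word js'"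
  by (simp add: block_word_def)

lemma block_word_concat: "block_word (concat (map f js)) = concat (map (\<lambda>j. block_word (f j)) js)"
  by (induction js) (simp_all add: block_word_append, simp add: block_word_def)

lemma block_word_zeros_one: "block_word (replicate n 0 @ [1]) = replicate (Suc n) Hor @ [Ver]"
  by (induction n) (simp_all add: block_word_def)

text \<open>For \<open>j < s\<close> at least one horizontal letter is present: the last one takes
  the \<open>Ver\<close>, the others form blocks of their own.\<close>

lemma mutated_word_block_word:
  assumes "\<forall>j\<in>set js. j < s"
  shows "mutated_word s js = block_word (concat (map (\<lambda>j. replicate (s - j - 1) 0 @ [1]) js))"
proof -
  have "replicate (s - j) Hor @ [Ver] = block_word (replicate (s - j - 1) 0 @ [1])"
    if "j \<in> set js" for j
  proof -
    have "s - j = Suc (s - j - 1)" using assms that by fastforce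
    then show ?thesis by (metis block_word_zeros_one)
  qed
  then show ?thesis
    unfolding mutated_word_def block_word_concat by (metis (no_types, lifting) map_cong)
qed

text \<open>\<open>True\<close> stands for the pair h, h v, so every block h v directly follows a
  block h.\<close>

definition sparse :: "bool list \<Rightarrow> nat list" where
  "sparse ts = concat (map (\<lambda>t. if t then [0, 1] else [0]) ts)"

lemma sparse_append: "sparse (ts @ ts') = sparse ts @ sparse ts'"
  by (simp add: sparse_def)

lemma sparse_zeros: "sparse (replicate n False) = replicate n 0"
  by (induction n) (simp_all add: sparse_def)

lemma sparse_concat: "sparse (concat (map f js)) = concat (map (\<lambda>j. sparse (f j)) js)"
  by (induction js) (simp_all add: sparse_append, simp add: sparse_def)

text \<open>For s = 1 a block h v loses its horizontal letter, and the remaining v joins the block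
  before it.\<close>

lemma mutated_word_sparse:
  "mutated_word 1 (sparse ts) = block_word (map (\<lambda>t. if t then 2 else 1) ts)"
  by (induction ts) (auto simp: sparse_def mutated_word_def block_word_def numeral_2_eq_2)

text \<open>The exponents \<open>j\<close> of the blocks \<open>h v\<^sup>j\<close> that occur when \<open>r s \<ge> 4\<close>. If \<open>s = 1\<close>, the ones must be
  isolated, since a run of ones merges into a single higher exponent at the next step.\<close>

definition admissible :: "nat \<Rightarrow> nat \<Rightarrow> nat list \<Rightarrow> bool" where
  "admissible r s js \<longleftrightarrow>
     r \<ge> 2 \<and> s \<ge> 2 \<and> set js \<subseteq> {0, 1} \<or>
     r = 1 \<and> s \<ge> 4 \<and> set js \<subseteq> {0, 1, 2} \<or>
     s = 1 \<and> r \<ge> 4 \<and> (\<exists>ts. js = sparse ts)"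

lemma admissible_le:
  assumes "admissible r s js"
  shows "\<forall>j\<in>set js. j \<le> s"
proof -
  have "set (sparse ts) \<subseteq> {0, 1}" for ts
    by (auto simp: sparse_def split: if_splits)
  then show ?thesis using assms unfolding admissible_def by fastforce
qed

text \<open>The first kind of list reproduces itself; the other two alternate as \<open>r\<close>
  and \<open>s\<close> are exchanged.\<close>

lemma admissible_mutated:
  assumes "admissible r s js"
  shows "\<exists>js'. mutated_word s js = block_word js' \<and> admissible s r js'"
proof -
  consider "r \<ge> 2" "s \<ge> 2" "set js \<subseteq> {0, 1}" | "r = 1" "s \<ge> 4" "set js \<subseteq> {0, 1, 2}"
    | ts where "s = 1" "r \<ge> 4" "js = sparse ts"
    using assms unfolding admissible_def by blast
  then show ?thesis
  proof cases
    case 1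
    then have "\<forall>j\<in>set js. j < s" by fastforce
    from mutated_word_block_word[OF this] 1 show ?thesis
      unfolding admissible_def
      by (intro exI[of _ "concat (map (\<lambda>j. replicate (s - j - 1) 0 @ [1]) js)"]) auto
  next
    case 2
    \<comment> \<open>As \<open>s \<ge> 4\<close> and \<open>j \<le> 2\<close>, at least one 0
      precedes the closing 1 and forms a \<open>True\<close> with it.\<close>
    define f where "f j = replicate (s - j - 2) False @ [True]" for j
    have "replicate (s - j - 1) 0 @ [1] = sparse (f j)" if "j \<in> set js" for j
    proof -
      have "s - j - 1 = Suc (s - j - 2)" using that 2 by auto
      then show ?thesis
        unfolding f_def sparse_append sparse_zeros
        by (simp add: sparse_def replicate_app_Cons_same)
    qed
    then have "concat (map (\<lambda>j. replicate (s - j - 1) 0 @ [1]) js) = sparse (concat (map f js))"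
      unfolding sparse_concat by (metis (no_types, lifting) map_cong)
    moreover have "\<forall>j\<in>set js. j < s" using 2 by fastforce
    ultimately show ?thesis
      using mutated_word_block_word[of js s] 2 unfolding admissible_def by metis
  next
    case 3
    then show ?thesis
      using mutated_word_sparse[of ts] unfolding admissible_def
      by (intro exI[of _ "map (\<lambda>t. if t then 2 else 1) ts"]) auto
  qed
qed

lemma admissible_start:
  assumes "r * s \<ge> 4"
  shows "admissible r s [0]"
proof -
  have "r > 0" "s > 0" using assms by (auto intro: gr0I)
  then consider "r \<ge> 2" "s \<ge> 2" | "r = 1" | "s = 1" by linarith
  then show ?thesis
  proof cases
    case 3
    have "[0] = sparse [False]" by (simp add: sparse_def)
    then show ?thesis using 3 assms unfolding admissible_def by auto
  qed (use assms in \<open>auto simp: admissible_def\<close>)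
qed

section \<open>Iterating the automorphisms\<close>

locale kontsevich = laurent_pair x y for x y :: "'a::division_ring" +
  fixes F :: "nat \<Rightarrow> 'a \<Rightarrow> 'a"
  assumes F_add: "r > 0 \<Longrightarrow> F r (a + b) = F r a + F r b"
    and F_mult: "r > 0 \<Longrightarrow> F r (a * b) = F r a * F r b"
    and F_one: "r > 0 \<Longrightarrow> F r 1 = 1"
    and F_x: "r > 0 \<Longrightarrow> F r x = x * y * inverse x"
    and F_y: "r > 0 \<Longrightarrow> F r y = (1 + y ^ r) * inverse x"
begin

lemma mutation_F:
  assumes "r > 0" "s > 0"
  shows "mutation x y r s (\<lambda>z. y * inverse x * F r z * x * inverse y)"
proof
  show "y * inverse x * F r (a * b) * x * inverse y
      = y * inverse x * F r a * x * inverse y * (y * inverse x * F r b * x * inverse y)" for a b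
  proof -
    have "y * inverse x * F r a * x * inverse y * (y * inverse x * F r b * x * inverse y)
        = y * inverse x * F r a * (x * ((inverse y * y) * inverse x)) * F r b * x * inverse y"
      by (simp only: mult.assoc)
    then show ?thesis
      using assms by (simp only: F_mult left_inverse right_inverse x_nz y_nz
          not_False_eq_True mult_1_left mult_1_right mult.assoc)
  qed
  show "y * inverse x * F r x * x * inverse y = y"
    using assms by (simp add: F_x mult.assoc)
  show "y * inverse x * F r y * x * inverse y = y * inverse x * (1 + y ^ r) * inverse y"
    using assms by (simp only: F_y left_inverse x_nz not_False_eq_True mult_1_right mult.assoc)
  show "y * inverse x * F r (a + b) * x * inverse y
      = y * inverse x * F r a * x * inverse y + y * inverse x * F r b * x * inverse y" for a b
    using assms by (simp add: F_add distrib_left distrib_right)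
  show "y * inverse x * F r 1 * x * inverse y = 1"
    using assms by (simp only: F_one left_inverse right_inverse x_nz y_nz not_False_eq_True
        mult_1_right mult.assoc)
qed (use assms in auto)

section \<open>The invariant commutator\<close>

definition q :: 'a where "q = x * y * inverse x * inverse y"

lemma inverse_q: "inverse q = y * x * inverse y * inverse x"
  by (simp add: q_def nonzero_inverse_mult_distrib mult.assoc)

lemma F_inverse:
  assumes "r > 0"
  shows "F r (inverse a) = inverse (F r a)"
proof (cases "a = 0")
  case True
  have "F r 0 = 0" using F_add[OF assms, of 0 0] by simp
  then show ?thesis using True by simp
next
  case False
  then have "F r a * F r (inverse a) = 1"
    using assms by (simp add: F_one flip: F_mult)
  then show ?thesis by (metis inverse_unique)
qed

text \<open>The images of y and y^-1 contribute T and its inverse, which cancel because T commutes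
  with y.\<close>

lemma F_q:
  assumes "r > 0"
  shows "F r q = q"
proof -
  let ?T = "1 + y ^ r"
  have T: "?T \<noteq> 0"
    using mutation.y_image_nz[OF mutation_F[OF assms assms]] .
  have "y * ?T = ?T * y" by (simp add: algebra_simps power_commutes)
  then have c: "inverse y * inverse ?T = inverse ?T * inverse y"
    using T by (metis nonzero_inverse_mult_distrib y_nz)
  have "F r q = x * y * (inverse x * ?T * (inverse x * x) * inverse y * (inverse x * x) * inverse ?T)"
    using assms T
    by (simp only: q_def F_mult F_inverse F_x F_y nonzero_inverse_mult_distrib x_nz y_nz
        inverse_nonzero_iff_nonzero nonzero_inverse_inverse_eq mult_eq_0_iff
        not_False_eq_True simp_thms mult.assoc)
  also have "\<dots> = x * y * inverse x * ?T * (inverse y * inverse ?T)"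
    by (simp only: left_inverse x_nz not_False_eq_True mult_1_right mult.assoc)
  also have "\<dots> = x * y * inverse x * (?T * inverse ?T) * inverse y"
    unfolding c by (simp only: mult.assoc)
  finally show ?thesis using T by (simp add: q_def)
qed

lemma alternating_comp_mult:
  assumes "r1 > 0" "r2 > 0"
  shows "alternating_comp F r1 r2 k (a * b)
    = alternating_comp F r1 r2 k a * alternating_comp F r1 r2 k b"
  using assms by (induction k arbitrary: r1 r2) (auto simp: F_mult)

lemma alternating_comp_q:
  assumes "r1 > 0" "r2 > 0"
  shows "alternating_comp F r1 r2 k q = q"
    and "alternating_comp F r1 r2 k (inverse q) = inverse q"
  using assms by (induction k arbitrary: r1 r2) (auto simp: F_q F_inverse)

text \<open>The innermost map sends x to x y x^-1 = q y, and the outer maps fix q.\<close>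

lemma alternating_comp_x:
  assumes "r1 > 0" "r2 > 0"
  shows "alternating_comp F r1 r2 (Suc k) x = q * alternating_comp F r1 r2 k y"
  using assms
proof (induction k arbitrary: r1 r2)
  case 0
  then show ?case by (simp add: F_x q_def mult.assoc)
next
  case (Suc k)
  then have "alternating_comp F r2 r1 (Suc k) x = q * alternating_comp F r2 r1 k y" by blast
  then show ?case using Suc.prems by (simp add: F_mult F_q)
qed

lemma alternating_comp_add:
  "alternating_comp F r1 r2 (n + m) a = alternating_comp F r1 r2 n
     (if even n then alternating_comp F r1 r2 m a else alternating_comp F r2 r1 m a)"
  by (induction n arbitrary: r1 r2) auto

text \<open>The count starts at one factor, where F_r1(y) = x (x^-1 (1 + y^r1)) x^-1 is given by a
  single \<open>Hor\<close>; so r1 is the horizontal exponent.\<close>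

definition encodes :: "nat \<Rightarrow> nat \<Rightarrow> nat \<Rightarrow> letter list \<Rightarrow> bool" where
  "encodes r1 r2 k w \<longleftrightarrow>
     alternating_comp F r1 r2 (Suc k) y = x * run r2 r1 [] w * inverse x"

lemma encodes_0: "r1 > 0 \<Longrightarrow> encodes r1 r2 0 (block_word [0])"
  by (simp add: encodes_def block_word_def F_y distrib_left distrib_right mult.assoc[symmetric])

text \<open>As F_r(x) = x y x^-1, the map of \<open>mutation_F\<close> appears between x and x^-1,
  and the outer conjugation persists.\<close>

lemma F_conj:
  assumes "r > 0"
  shows "F r (x * a * inverse x) = x * (y * inverse x * F r a * x * inverse y) * inverse x"
  using assms by (simp add: F_mult F_inverse F_x nonzero_inverse_mult_distrib mult.assoc)

lemma encodes_Suc: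
  assumes "r1 > 0" "r2 > 0"
    and "encodes r2 r1 k (block_word js)" and "\<forall>j\<in>set js. j \<le> r2"
  shows "encodes r1 r2 (Suc k) (mutated_word r2 js)"
  using mutation.image_run[OF mutation_F[OF assms(1,2)] assms(4)] assms(1,3)
  by (simp add: encodes_def F_conj)

lemma encodes_Ver:
  assumes "r1 > 0" "r2 > 0" and "encodes r2 r1 k [Ver]"
  shows "alternating_comp F r1 r2 (Suc (Suc k)) y = x * inverse q"
proof -
  have "alternating_comp F r1 r2 (Suc (Suc k)) y
      = F r1 (x * (inverse y + x ^ r1 * inverse y) * inverse x)"
    using assms(3) by (simp add: encodes_def)
  also have "\<dots> = x * (y * x * inverse y) * inverse x"
    unfolding F_conj[OF assms(1)] mutation.\<Psi>_ver[OF mutation_F[OF assms(1,2)]] ..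
  finally show ?thesis by (simp only: inverse_q mult.assoc)
qed

lemma encodes_admissible:
  assumes "r1 * r2 \<ge> 4"
  shows "\<exists>js. encodes r1 r2 k (block_word js) \<and> admissible r2 r1 js"
  using assms
proof (induction k arbitrary: r1 r2)
  case 0
  then have "r1 > 0" by (auto intro: gr0I)
  then show ?case using encodes_0 admissible_start[of r2 r1] 0 by (metis mult.commute)
next
  case (Suc k)
  then have pos: "r1 > 0" "r2 > 0" by (auto intro: gr0I)
  obtain js where js: "encodes r2 r1 k (block_word js)" "admissible r1 r2 js"
    using Suc.IH[of r2 r1] Suc.prems by (auto simp: mult.commute)
  then show ?case
    using encodes_Suc[OF pos js(1) admissible_le[OF js(2)]] admissible_mutated[OF js(2)] by metis
qed

lemma nonneg_laurent_encodes:
  assumes "encodes r1 r2 k w"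
  shows "nonneg_laurent_polynomial x y (alternating_comp F r1 r2 (Suc k) y)"
proof -
  have "nonneg_laurent_polynomial x y (x * run r2 r1 [] w * inverse x)"
    by (intro nonneg_laurent_mult_right nonneg_laurent_mult_left nonneg_laurent_run) auto
  then show ?thesis using assms unfolding encodes_def by simp
qed

lemma nonneg_laurent_q:
  assumes "nonneg_laurent_polynomial x y p"
  shows "nonneg_laurent_polynomial x y (q * p)" "nonneg_laurent_polynomial x y (p * inverse q)"
proof -
  have "nonneg_laurent_polynomial x y (x * (y * (inverse x * (inverse y * p))))"
    "nonneg_laurent_polynomial x y (p * y * x * inverse y * inverse x)"
    by (intro nonneg_laurent_mult_left nonneg_laurent_mult_right assms; simp)+
  then show "nonneg_laurent_polynomial x y (q * p)" "nonneg_laurent_polynomial x y (p * inverse q)"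
    by (simp_all only: inverse_q) (simp_all only: q_def mult.assoc)
qed

lemma nonneg_laurent_gens:
  "nonneg_laurent_polynomial x y x" "nonneg_laurent_polynomial x y y"
  using nonneg_laurent_mult_left[OF nonneg_laurent_1, of x x y]
    nonneg_laurent_mult_left[OF nonneg_laurent_1, of y x y] by simp_all

lemma nonneg_laurent_infinite_type:
  assumes "r1 * r2 \<ge> 4"
  shows "nonneg_laurent_polynomial x y (alternating_comp F r1 r2 k x)"
proof -
  have pos: "r1 > 0" "r2 > 0" using assms by (auto intro: gr0I)
  have "nonneg_laurent_polynomial x y (alternating_comp F r1 r2 (Suc m) x)" for m
  proof (cases m)
    case 0
    then show ?thesis
      unfolding alternating_comp_x[OF pos] by (simp add: nonneg_laurent_q nonneg_laurent_gens)
  next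
    case (Suc m')
    then show ?thesis
      unfolding alternating_comp_x[OF pos]
      using encodes_admissible[OF assms] nonneg_laurent_encodes nonneg_laurent_q by blast
  qed
  then show ?thesis by (cases k) (auto simp: nonneg_laurent_gens simp del: alternating_comp.simps(2))
qed

text \<open>Once the word is \<open>[Ver]\<close>, \<open>encodes_Ver\<close> leads back to x:
  x_{n+K+3} = q x_n q^-1.\<close>

lemma nonneg_laurent_finite_type:
  assumes pos: "r1 > 0" "r2 > 0"
    and enc: "\<And>k. k \<le> K \<Longrightarrow> \<exists>w. encodes r1 r2 k w"
    and Ver: "encodes r1 r2 K [Ver]" "encodes r2 r1 K [Ver]"
  shows "nonneg_laurent_polynomial x y (alternating_comp F r1 r2 k x)"
proof (induction k rule: less_induct)
  case (less k)
  consider "k = 0" | "k = 1" | m where "k = Suc (Suc m)" "m \<le> K"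
    | n where "k = Suc (n + Suc (Suc K))"
  proof (cases k)
    case (Suc m)
    then show ?thesis
    proof (cases "m \<le> Suc K")
      case True
      then show ?thesis using Suc that by (cases m) auto
    next
      case False
      then have "k = Suc ((m - Suc (Suc K)) + Suc (Suc K))" using Suc by simp
      then show ?thesis using that(4) by blast
    qed
  qed (use that in auto)
  then show ?case
  proof cases
    case 1
    then show ?thesis by (simp add: nonneg_laurent_gens)
  next
    case 2
    then show ?thesis
      using alternating_comp_x[OF pos, of 0] by (simp add: nonneg_laurent_q nonneg_laurent_gens)
  next
    case 3
    then show ?thesis
      unfolding \<open>k = _\<close> alternating_comp_x[OF pos]
      using enc nonneg_laurent_encodes nonneg_laurent_q by blast
  next
    case 4
    \<comment> \<open>The parity of \<open>n\<close> decides which index the inner composition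
      starts with, hence both assumptions on \<open>[Ver]\<close>.\<close>
    have "alternating_comp F r1 r2 k x = q * alternating_comp F r1 r2 n (x * inverse q)"
      unfolding \<open>k = _\<close> alternating_comp_x[OF pos] alternating_comp_add
      using encodes_Ver[OF pos Ver(2)] encodes_Ver[OF pos(2,1) Ver(1)] by simp
    also have "\<dots> = q * (alternating_comp F r1 r2 n x * inverse q)"
      by (simp add: alternating_comp_mult alternating_comp_q pos)
    finally show ?thesis using less[of n] 4 nonneg_laurent_q by simp
  qed
qed

section \<open>The finite types A2, B2 and G2, with periods 5, 6 and 8\<close>

lemmas word_defs = block_word_def mutated_word_def eval_nat_numeral

lemma encodes_step:
  assumes "encodes r2 r1 k (block_word js)" and "r1 > 0" "r2 > 0" and "\<forall>j\<in>set js. j \<le> r2"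
    and "mutated_word r2 js = w"
  shows "encodes r1 r2 (Suc k) w"
  using encodes_Suc[OF assms(2,3,1,4)] assms(5) by simp

lemma encodes_1_1:
  "encodes 1 1 0 (block_word [0])" "encodes 1 1 1 (block_word [1])" "encodes 1 1 2 [Ver]"
proof -
  show 0: "encodes 1 1 0 (block_word [0])" by (rule encodes_0) simp
  show 1: "encodes 1 1 1 (block_word [1])"
    using encodes_step[OF 0] by (simp add: word_defs)
  show 2: "encodes 1 1 2 [Ver]"
    using encodes_step[OF 1] by (simp add: word_defs)
qed

text \<open>Each step exchanges the two indices, so both sequences are built together.\<close>

lemma encodes_1_2:
  "encodes 1 2 0 (block_word [0])" "encodes 1 2 1 (block_word [0, 1])"
  "encodes 1 2 2 (block_word [1])" "encodes 1 2 3 [Ver]"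
  "encodes 2 1 0 (block_word [0])" "encodes 2 1 1 (block_word [1])"
  "encodes 2 1 2 (block_word [2])" "encodes 2 1 3 [Ver]"
proof -
  show a0: "encodes 1 2 0 (block_word [0])" by (rule encodes_0) simp
  show b0: "encodes 2 1 0 (block_word [0])" by (rule encodes_0) simp
  show a1: "encodes 1 2 1 (block_word [0, 1])" using encodes_step[OF b0] by (simp add: word_defs)
  show b1: "encodes 2 1 1 (block_word [1])" using encodes_step[OF a0] by (simp add: word_defs)
  show a2: "encodes 1 2 2 (block_word [1])" using encodes_step[OF b1] by (simp add: word_defs)
  show b2: "encodes 2 1 2 (block_word [2])" using encodes_step[OF a1] by (simp add: word_defs)
  show "encodes 1 2 3 [Ver]" using encodes_step[OF b2] by (simp add: word_defs)
  show "encodes 2 1 3 [Ver]" using encodes_step[OF a2] by (simp add: word_defs)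
qed

lemma encodes_1_3:
  "encodes 1 3 0 (block_word [0])" "encodes 1 3 1 (block_word [0, 0, 1])"
  "encodes 1 3 2 (block_word [0, 1])" "encodes 1 3 3 (block_word [0, 1, 1])"
  "encodes 1 3 4 (block_word [1])" "encodes 1 3 5 [Ver]"
  "encodes 3 1 0 (block_word [0])" "encodes 3 1 1 (block_word [1])"
  "encodes 3 1 2 (block_word [1, 2])" "encodes 3 1 3 (block_word [2])"
  "encodes 3 1 4 (block_word [3])" "encodes 3 1 5 [Ver]"
proof -
  show a0: "encodes 1 3 0 (block_word [0])" by (rule encodes_0) simp
  show b0: "encodes 3 1 0 (block_word [0])" by (rule encodes_0) simp
  show a1: "encodes 1 3 1 (block_word [0, 0, 1])" using encodes_step[OF b0] by (simp add: word_defs)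
  show b1: "encodes 3 1 1 (block_word [1])" using encodes_step[OF a0] by (simp add: word_defs)
  show a2: "encodes 1 3 2 (block_word [0, 1])" using encodes_step[OF b1] by (simp add: word_defs)
  show b2: "encodes 3 1 2 (block_word [1, 2])" using encodes_step[OF a1] by (simp add: word_defs)
  show a3: "encodes 1 3 3 (block_word [0, 1, 1])" using encodes_step[OF b2] by (simp add: word_defs)
  show b3: "encodes 3 1 3 (block_word [2])" using encodes_step[OF a2] by (simp add: word_defs)
  show a4: "encodes 1 3 4 (block_word [1])" using encodes_step[OF b3] by (simp add: word_defs)
  show b4: "encodes 3 1 4 (block_word [3])" using encodes_step[OF a3] by (simp add: word_defs)
  show "encodes 1 3 5 [Ver]" using encodes_step[OF b4] by (simp add: word_defs)
  show "encodes 3 1 5 [Ver]" using encodes_step[OF a4] by (simp add: word_defs)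
qed

lemma nonneg_laurent_alternating_comp:
  assumes pos: "r1 > 0" "r2 > 0"
  shows "nonneg_laurent_polynomial x y (alternating_comp F r1 r2 k x)"
proof (cases "r1 * r2 \<ge> 4")
  case True
  then show ?thesis by (rule nonneg_laurent_infinite_type)
next
  case False
  have "r1 \<le> r1 * r2" "r2 \<le> r1 * r2" using pos by auto
  then have "r1 < 4" "r2 < 4" using False by linarith+
  then have "r1 \<in> {1, 2, 3}" "r2 \<in> {1, 2, 3}" using pos by auto
  then consider "r1 = 1" "r2 = 1" | "r1 = 1" "r2 = 2" | "r1 = 2" "r2 = 1"
    | "r1 = 1" "r2 = 3" | "r1 = 3" "r2 = 1"
    using False by auto
  then show ?thesis
  proof cases
    case 1
    have "\<exists>w. encodes r1 r2 k w" if "k \<le> 2" for k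
    proof -
      have "k \<in> {0, 1, 2}" using that by auto
      then show ?thesis using 1 encodes_1_1 by blast
    qed
    then show ?thesis using nonneg_laurent_finite_type[of r1 r2 2 k] 1 encodes_1_1 by simp
  next
    case 2
    have "\<exists>w. encodes r1 r2 k w" if "k \<le> 3" for k
    proof -
      have "k \<in> {0, 1, 2, 3}" using that by auto
      then show ?thesis using 2 encodes_1_2 by blast
    qed
    then show ?thesis using nonneg_laurent_finite_type[of r1 r2 3 k] 2 encodes_1_2 by simp
  next
    case 3
    have "\<exists>w. encodes r1 r2 k w" if "k \<le> 3" for k
    proof -
      have "k \<in> {0, 1, 2, 3}" using that by auto
      then show ?thesis using 3 encodes_1_2 by blast
    qed
    then show ?thesis using nonneg_laurent_finite_type[of r1 r2 3 k] 3 encodes_1_2 by simp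
  next
    case 4
    have "\<exists>w. encodes r1 r2 k w" if "k \<le> 5" for k
    proof -
      have "k \<in> {0, 1, 2, 3, 4, 5}" using that by auto
      then show ?thesis using 4 encodes_1_3 by blast
    qed
    then show ?thesis using nonneg_laurent_finite_type[of r1 r2 5 k] 4 encodes_1_3 by simp
  next
    case 5
    have "\<exists>w. encodes r1 r2 k w" if "k \<le> 5" for k
    proof -
      have "k \<in> {0, 1, 2, 3, 4, 5}" using that by auto
      then show ?thesis using 5 encodes_1_3 by blast
    qed
    then show ?thesis using nonneg_laurent_finite_type[of r1 r2 5 k] 5 encodes_1_3 by simp
  qed
qed

end

theorem theorem1:
  fixes \<phi> :: "(two_vars, 'k::field_char_0) free_algebra \<Rightarrow> 'K::division_ring"
    and F :: "nat \<Rightarrow> 'K \<Rightarrow> 'K"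
    and x y :: 'K
    and r1 r2 k :: nat
  assumes K: "universal_field_of_fractions ring_of_type_algebra ring_of_type_algebra \<phi>"
    and x: "x = \<phi> (gen X_var)"
    and y: "y = \<phi> (gen Y_var)"
    and F_aut: "\<And>r. r > 0 \<Longrightarrow> F r \<in> ring_iso ring_of_type_algebra ring_of_type_algebra"
    and F_linear: "\<And>r c a. r > 0 \<Longrightarrow> F r (\<phi> (scalar c) * a) = \<phi> (scalar c) * F r a"
    and F_x: "\<And>r. r > 0 \<Longrightarrow> F r x = x * y * inverse x"
    and F_y: "\<And>r. r > 0 \<Longrightarrow> F r y = (1 + y ^ r) * inverse x"
    and r1: "r1 > 0"
    and r2: "r2 > 0"
  shows "nonneg_laurent_polynomial x y (alternating_comp F r1 r2 k x)"
proof -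
  have inj: "inj \<phi>" and hom: "\<phi> (a + b) = \<phi> a + \<phi> b" for a b
    using K by (auto simp: universal_field_of_fractions_def epic_field_def ring_hom_def
        ring_of_type_algebra_def)
  \<comment> \<open>Injectivity of \<open>\<phi>\<close> carries the nonvanishing of the generators
    over to x and y.\<close>
  have "\<phi> 0 = 0" using hom[of 0 0] by simp
  moreover have "gen v \<noteq> (0 :: (two_vars, 'k) free_algebra)" for v
    by (metis gen_def lookup_single_eq lookup_zero zero_neq_one)
  ultimately have nz: "x \<noteq> 0" "y \<noteq> 0"
    using inj unfolding x y by (metis injD)+
  interpret kontsevich x y F
    by unfold_locales
      (use F_aut F_x F_y nz in \<open>auto simp: ring_iso_def ring_hom_def ring_of_type_algebra_def\<close>)
  show ?thesis by (rule nonneg_laurent_alternating_comp[OF r1 r2])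
qed

end
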